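(* Let $G$ be a cubic graph (every vertex has degree $3$). Then $P^1(G)\leq 3$; that is, there is a proper pushing scheme $\rho:V(G)\to\{0,1,2,3\}$ of $G$.
   Context: Graphs are finite, simple and undirected. For a graph $G$, a function $\rho:V(G)\to\mathbb{N}_0$ (where $\mathbb{N}_0=\{0,1,2,\dots\}$) is a proper pushing scheme of $G$ if the function $\sigma:V(G)\to\mathbb{N}_0$, $\sigma(u)=(1+\rho(u))d_G(u)+\sum_{v\in N_G(u)}\rho(v)$, satisfies $\sigma(u)\neq\sigma(v)$ for every edge $uv$ of $G$. A graph is nice if it has no connected component of order two (cubic graphs are nice). For a nice graph $G$, $P^1(G)=\min\{\max_{u\in V(G)}\rho(u): \rho \text{ a proper pushing scheme of } G\}$. *)

theory Defs
  imports "Graph_Theory.Pair_Digraph"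
begin

text \<open>
  A finite simple undirected graph is a \<open>pair_graph\<close>: a finite, loop-free digraph whose arc
  relation is symmetric, each edge \<open>uv\<close> being present as both \<open>(u, v)\<close> and \<open>(v, u)\<close>.
  Thus the degree of a vertex is its \<open>out_degree\<close>.
\<close>

definition nbhd :: "'a pair_pre_digraph \<Rightarrow> 'a \<Rightarrow> 'a set" where
  "nbhd G u = {v. (u, v) \<in> parcs G}"

definition cubic_graph :: "'a pair_pre_digraph \<Rightarrow> bool" where
  "cubic_graph G \<longleftrightarrow> pair_graph G \<and> (\<forall>u\<in>pverts G. out_degree G u = 3)"

definition push_sigma :: "'a pair_pre_digraph \<Rightarrow> ('a \<Rightarrow> nat) \<Rightarrow> 'a \<Rightarrow> nat" where
  "push_sigma G \<rho> u = (1 + \<rho> u) * out_degree G u + (\<Sum>v\<in>nbhd G u. \<rho> v)"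

text \<open>Only the values of \<open>\<rho>\<close> on the vertices of \<open>G\<close> matter here.\<close>

definition proper_pushing_scheme :: "'a pair_pre_digraph \<Rightarrow> ('a \<Rightarrow> nat) \<Rightarrow> bool" where
  "proper_pushing_scheme G \<rho> \<longleftrightarrow>
     (\<forall>u v. (u, v) \<in> parcs G \<longrightarrow> push_sigma G \<rho> u \<noteq> push_sigma G \<rho> v)"

text \<open>
  On \<open>nat\<close>, \<open>Sup\<close> of a finite nonempty set is its maximum (and \<open>Sup {} = 0\<close>, which covers the
  graph without vertices), and \<open>Inf\<close> of a nonempty set is its minimum. The definition is only
  meaningful for graphs that have a proper pushing scheme; it is intended for graphs without
  a connected component of order two.
\<close>

definition P1 :: "'a pair_pre_digraph \<Rightarrow> nat" where
  "P1 G = Inf {(SUP u\<in>pverts G. \<rho> u) | \<rho>. proper_pushing_scheme G \<rho>}"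

end

theory Submission
  imports Defs
begin

text \<open>
  Put \<open>3\<close> on a maximal independent set \<open>I\<close>. The graph induced on the complement has maximum degree
  at most two. On its nontrivial components use \<open>0\<close> and \<open>1\<close> alternately, or \<open>2, 0, 0, 0, 1, 0, 1, \<dots>\<close>
  around an odd cycle (\<open>2, 0, 1\<close> around a triangle): no two neighbours within a component get the
  same sum, and each sum stays below those at the neighbours in \<open>I\<close>. For a vertex \<open>u\<close> with all neighbours in \<open>I\<close>
  it remains to ensure that \<open>3 * \<rho> u\<close> differs from the sum of \<open>\<rho>\<close> over the neighbourhood of each
  neighbour \<open>v\<close> of \<open>u\<close>; viewing these neighbourhoods as hyperedges of size three, a greedy colouring
  succeeds.
\<close>

section \<open>Loads outside the independent set\<close>

text \<open>
  Here \<open>N u\<close> is the set of neighbours of \<open>u\<close> outside the independent set; the \<open>3 - card (N u)\<close>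
  neighbours inside it contribute \<open>3\<close> each. An independent neighbour of \<open>u\<close> receives at least
  \<open>9 + f u\<close>, so the last condition of \<open>well_loaded\<close> settles the edges into the independent set.
\<close>

definition load :: "('a \<Rightarrow> 'a set) \<Rightarrow> ('a \<Rightarrow> nat) \<Rightarrow> 'a \<Rightarrow> nat" where
  "load N f u = 3 * f u + sum f (N u) + 3 * (3 - card (N u))"

definition well_loaded :: "('a \<Rightarrow> 'a set) \<Rightarrow> ('a \<Rightarrow> nat) \<Rightarrow> 'a \<Rightarrow> bool" where
  "well_loaded N f u \<longleftrightarrow> f u \<le> 2 \<and> (\<forall>w\<in>N u. load N f u \<noteq> load N f w) \<and>
     (N u \<noteq> {} \<longrightarrow> load N f u < 9 + f u)"

lemma load_cong:
  assumes "f u = g u" "\<And>w. w \<in> N u \<Longrightarrow> f w = g w"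
  shows "load N f u = load N g u"
  unfolding load_def using assms by (simp cong: sum.cong)

text \<open>A set closed under \<open>N\<close> contains everything that \<open>well_loaded\<close>
  inspects from inside it, so weightings found on different components can be glued.\<close>

lemma well_loaded_cong:
  assumes "\<And>w. w \<in> C \<Longrightarrow> N w \<subseteq> C" "\<And>w. w \<in> C \<Longrightarrow> f w = g w" "u \<in> C"
  shows "well_loaded N f u = well_loaded N g u"
proof -
  have "load N f w = load N g w" if "w \<in> C" for w
    using assms(1,2) that by (intro load_cong) auto
  then show ?thesis
    unfolding well_loaded_def using assms by (metis subsetD)
qed

section \<open>Weights along paths and cycles\<close>

text \<open>For degree 1 or 2 respectively, a vertex of value 0 has load 7 or 5 and a vertex of
  value 1 has load 9 or 6; no load of the first kind equals one of the second.\<close>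

lemma well_loaded_if_alternating:
  assumes N: "finite (N u)" "card (N u) \<le> 2" "\<And>w. w \<in> N u \<Longrightarrow> finite (N w) \<and> card (N w) \<le> 2 \<and> N w \<noteq> {}"
    and f: "f u \<le> 1" "\<And>w. w \<in> N u \<Longrightarrow> f w = 1 - f u"
    and f2: "\<And>w x. w \<in> N u \<Longrightarrow> x \<in> N w \<Longrightarrow> f x = f u"
  shows "well_loaded N f u"
proof -
  have l: "load N f u = 3 * f u + card (N u) * (1 - f u) + 3 * (3 - card (N u))"
    unfolding load_def using f by simp
  have lw: "load N f w = 3 * (1 - f u) + card (N w) * f u + 3 * (3 - card (N w))" if "w \<in> N u" for w
    unfolding load_def using f f2 that by simp
  have c: "card (N u) = 1 \<or> card (N u) = 2" if "N u \<noteq> {}"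
    using N that by (metis One_nat_def card_eq_0_iff le_less less_2_cases)
  have cw: "card (N w) = 1 \<or> card (N w) = 2" if "w \<in> N u" for w
    using N(3)[OF that] by (metis One_nat_def card_eq_0_iff le_less less_2_cases)
  have fu: "f u = 0 \<or> f u = 1" using f(1) by auto
  have "load N f u \<noteq> load N f w" if "w \<in> N u" for w
    proof -
    have "card (N u) = 1 \<or> card (N u) = 2" using c that by blast
    then show ?thesis using cw[OF that] fu unfolding l lw[OF that] by (elim disjE) simp_all
  qed
  moreover have "load N f u < 9 + f u" if "N u \<noteq> {}"
    using c[OF that] fu unfolding l by auto
  ultimately show ?thesis
    using fu unfolding well_loaded_def by auto
qed

definition odd_cycle_pattern :: "nat \<Rightarrow> nat \<Rightarrow> nat" where
  "odd_cycle_pattern m i = (if i = 0 then 2 else if i = 2 \<and> m = 3 then 1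
     else if i \<le> 2 then 0 else Suc i mod 2)"

text \<open>Around the cycle the sums \<open>3 * g i + g (nxt i) + g (prv i)\<close> read 7, 3, 5
  for \<open>m = 3\<close>; for \<open>m \<ge> 5\<close> they read 7, 2, 0, 1, then 3 and 2
  alternately, and 5 at the last position, where oddness of \<open>m\<close> puts the value 1. The
  bound 6 is 9 minus the 3 contributed by the single independent neighbour of a cycle
  vertex.\<close>

lemma odd_cycle_pattern:
  fixes m i :: nat
  defines "g \<equiv> odd_cycle_pattern m"
  defines "nxt \<equiv> \<lambda>i. if Suc i = m then 0 else Suc i"
    and "prv \<equiv> \<lambda>i. if i = 0 then m - 1 else i - 1"
  assumes m: "odd m" "3 \<le> m" and i: "i < m"
  shows "2 * g i + g (nxt i) + g (prv i) < 6"
    and "3 * g i + g (nxt i) + g (prv i) \<noteq> 3 * g (nxt i) + g (nxt (nxt i)) + g i"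
proof -
  have "m = 3 \<or> 5 \<le> m" using m by presburger
  then consider "m = 3" | "5 \<le> m" by blast
  then have "2 * g i + g (nxt i) + g (prv i) < 6 \<and>
    3 * g i + g (nxt i) + g (prv i) \<noteq> 3 * g (nxt i) + g (nxt (nxt i)) + g i"
  proof cases
    case 1
    then consider "i = 0" | "i = 1" | "i = 2" using i by linarith
    then show ?thesis
      using 1 by cases (simp_all add: g_def nxt_def prv_def odd_cycle_pattern_def)
  next
    case 2
    \<comment> \<open>From position 4 on all positions behave alike, except the last two, where
      \<open>nxt i\<close> or \<open>nxt (nxt i)\<close> wraps around to 0.\<close>
    then consider "i = 0" | "i = 1" | "i = 2" | "i = 3" | "4 \<le> i" "Suc (Suc i) < m"
      | "Suc (Suc i) = m" | "Suc i = m"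
      using i by linarith
    then show ?thesis
      using 2 m(1) by cases
        (auto simp: g_def nxt_def prv_def odd_cycle_pattern_def mod_2_eq_odd)
  qed
  then show "2 * g i + g (nxt i) + g (prv i) < 6"
    and "3 * g i + g (nxt i) + g (prv i) \<noteq> 3 * g (nxt i) + g (nxt (nxt i)) + g i"
    by blast+
qed

section \<open>Components under a degree bound of two\<close>

text \<open>A path of greatest length inside \<open>S\<close> will do: a neighbour of either end
  missing from it would lengthen it.\<close>

lemma maximal_path:
  assumes fin: "finite S" and ne: "S \<noteq> {}"
    and closed: "\<And>u. u \<in> S \<Longrightarrow> N u \<subseteq> S"
    and sym: "\<And>u v. u \<in> S \<Longrightarrow> v \<in> N u \<Longrightarrow> u \<in> N v"
  obtains c where "c \<noteq> []" "distinct c" "set c \<subseteq> S"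
    "\<And>i. Suc i < length c \<Longrightarrow> c ! Suc i \<in> N (c ! i)"
    "N (hd c) \<subseteq> set c" "N (last c) \<subseteq> set c"
proof -
  define P where "P c \<longleftrightarrow> c \<noteq> [] \<and> distinct c \<and> set c \<subseteq> S \<and>
    (\<forall>i. Suc i < length c \<longrightarrow> c ! Suc i \<in> N (c ! i))" for c
  obtain s where "s \<in> S" using ne by auto
  then have "P [s]" unfolding P_def by auto
  moreover have "length c < Suc (card S)" if "P c" for c
    using that card_mono[OF fin, of "set c"] distinct_card[of c] unfolding P_def by auto
  ultimately obtain c where c: "P c" and max: "\<And>d. P d \<Longrightarrow> length d \<le> length c"
    using ex_has_greatest_nat[of P "[s]" length "Suc (card S)"] by auto
  have "w \<in> set c" if "w \<in> N (hd c)" for w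
  proof (rule ccontr)
    assume w: "w \<notin> set c"
    have hd: "hd c \<in> S" using c unfolding P_def by auto
    have "P (w # c)"
      unfolding P_def
    proof (intro conjI allI impI)
      show "set (w # c) \<subseteq> S" using c closed[OF hd] that unfolding P_def by auto
      show "(w # c) ! Suc i \<in> N ((w # c) ! i)" if "Suc i < length (w # c)" for i
        using c that \<open>w \<in> N (hd c)\<close> sym[OF hd, of w] unfolding P_def
        by (cases i) (auto simp: hd_conv_nth)
    qed (use c w in \<open>auto simp: P_def\<close>)
    then show False using max[of "w # c"] by simp
  qed
  moreover have "w \<in> set c" if "w \<in> N (last c)" for w
  proof (rule ccontr)
    assume w: "w \<notin> set c"
    have last: "last c \<in> S" using c unfolding P_def by auto
    have "P (c @ [w])"
      unfolding P_def
    proof (intro conjI allI impI)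
      show "set (c @ [w]) \<subseteq> S" using c closed[OF last] that unfolding P_def by auto
      show "(c @ [w]) ! Suc i \<in> N ((c @ [w]) ! i)" if "Suc i < length (c @ [w])" for i
      proof (cases "Suc i < length c")
        case True
        then show ?thesis using c unfolding P_def by (simp add: nth_append)
      next
        case False
        then have "i = length c - 1" "Suc i = length c" using that by auto
        then show ?thesis using \<open>w \<in> N (last c)\<close> c unfolding P_def
          by (auto simp: nth_append last_conv_nth)
      qed
    qed (use c w in \<open>auto simp: P_def\<close>)
    then show False using max[of "c @ [w]"] by simp
  qed
  ultimately show thesis using c that unfolding P_def by blast
qed


text \<open>The vertices of the path from \<open>maximal_path\<close> form a component: its ends
  have no neighbours off the path, and an inner vertex already has two on it. They induce a path or
  a cycle, weighted by parity of position unless it is an odd cycle.\<close>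

lemma closed_component:
  assumes fin: "finite S" and ne: "S \<noteq> {}"
    and closed: "\<And>u. u \<in> S \<Longrightarrow> N u \<subseteq> S"
    and sym: "\<And>u v. u \<in> S \<Longrightarrow> v \<in> N u \<Longrightarrow> u \<in> N v"
    and irrefl: "\<And>u. u \<in> S \<Longrightarrow> u \<notin> N u"
    and deg: "\<And>u. u \<in> S \<Longrightarrow> card (N u) \<le> 2"
  obtains C f where "C \<noteq> {}" "C \<subseteq> S" "\<And>u. u \<in> C \<Longrightarrow> N u \<subseteq> C" "\<And>u. u \<in> C \<Longrightarrow> well_loaded N f u"
proof -
  obtain c where c: "c \<noteq> []" "distinct c" "set c \<subseteq> S"
    and step: "\<And>i. Suc i < length c \<Longrightarrow> c ! Suc i \<in> N (c ! i)"
    and hd: "N (hd c) \<subseteq> set c" and last: "N (last c) \<subseteq> set c"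
    using maximal_path[of S N] fin ne closed sym by blast
  define m where "m = length c"
  have inS: "c ! i \<in> S" if "i < m" for i using c(3) that unfolding m_def by auto
  have finN: "finite (N u)" if "u \<in> S" for u using fin closed[OF that] finite_subset by blast
  have eq_iff: "c ! i = c ! j \<longleftrightarrow> i = j" if "i < m" "j < m" for i j
    using that c(2) unfolding m_def by (simp add: nth_eq_iff_index_eq)
  have bwd: "c ! i \<in> N (c ! Suc i)" if "Suc i < m" for i
    using sym[of "c ! i"] inS[of i] step[of i] that unfolding m_def by simp
  have nbrs: "N (c ! i) = {c ! j, c ! k}"
    if "i < m" "j < m" "k < m" "j \<noteq> k" "c ! j \<in> N (c ! i)" "c ! k \<in> N (c ! i)" for i j k
  proof -
    have "card {c ! j, c ! k} = 2" using eq_iff[of j k] that by simp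
    then have "{c ! j, c ! k} = N (c ! i)"
      using that inS[of i] deg[of "c ! i"] finN[of "c ! i"] by (intro card_seteq) auto
    then show ?thesis by simp
  qed
  have inner: "N (c ! i) = {c ! (i - 1), c ! Suc i}" if "0 < i" "Suc i < m" for i
    using that nbrs[of i "i - 1" "Suc i"] bwd[of "i - 1"] step[of i] unfolding m_def by simp
  have C: "N u \<subseteq> set c" if u: "u \<in> set c" for u
  proof -
    obtain i where i: "i < m" "u = c ! i" using u unfolding m_def in_set_conv_nth by blast
    consider "i = 0" | "i = m - 1" | "0 < i" "Suc i < m" using i by linarith
    then show ?thesis
    proof cases
      case 1
      then show ?thesis using hd i c(1) by (simp add: hd_conv_nth)
    next
      case 2
      then show ?thesis using last i c(1) unfolding m_def by (simp add: last_conv_nth)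
    next
      case 3
      then show ?thesis using inner[OF 3] i unfolding m_def by auto
    qed
  qed
  \<comment> \<open>Since inner vertices have no room for further neighbours, the only edge between
    non-consecutive positions is one that joins the two ends.\<close>
  have adj: "j = Suc i \<or> i = 0 \<and> Suc j = m" if "i < j" "j < m" "c ! j \<in> N (c ! i)" for i j
  proof (cases "i = 0")
    case True
    show ?thesis
    proof (cases "Suc j = m")
      case False
      then have "c ! 0 \<in> {c ! (j - 1), c ! Suc j}"
        using inner[of j] sym[OF inS that(3)] that True by simp
      then have "c ! 0 = c ! (j - 1) \<or> c ! 0 = c ! Suc j" by blast
      moreover have "0 < m" "j - 1 < m" "Suc j < m" using that(1,2) False by linarith+
      ultimately have "0 = j - 1 \<or> 0 = Suc j" using eq_iff by blast
      then show ?thesis using that(1) True by linarith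
    qed (use True in simp)
  next
    case False
    then have "c ! j \<in> {c ! (i - 1), c ! Suc i}"
      using inner[of i] that by simp
    then have "c ! j = c ! (i - 1) \<or> c ! j = c ! Suc i" by blast
    moreover have "i - 1 < m" "Suc i < m" using that(1,2) by linarith+
    ultimately have "j = i - 1 \<or> j = Suc i" using eq_iff that(2) by blast
    then show ?thesis using that(1) by linarith
  qed
  define h where "h = inv_into {..<m} (\<lambda>i. c ! i)"
  have h: "h (c ! i) = i" if "i < m" for i
    unfolding h_def using that eq_iff by (intro inv_into_f_f) (auto simp: inj_on_def)
  have setc: "\<exists>i<m. u = c ! i" if "u \<in> set c" for u
    using that unfolding m_def in_set_conv_nth by blast
  have "\<exists>f. \<forall>u\<in>set c. well_loaded N f u"
  \<comment> \<open>Parity of position can fail only across a closing edge between positions 0 and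
    \<open>m - 1\<close> for odd \<open>m\<close>; \<open>3 \<le> m\<close> sets aside the single
    vertex \<open>m = 1\<close>.\<close>
  proof (cases "odd m \<and> 3 \<le> m \<and> c ! (m - 1) \<in> N (c ! 0)")
    case False
    define f where "f u = h u mod 2" for u
    have lt: "i mod 2 \<noteq> j mod 2" if "i < j" "j < m" "c ! j \<in> N (c ! i)" for i j
    proof (cases "j = Suc i")
      case False
      then have ij: "i = 0" "j = m - 1" using adj[OF that] by auto
      then have "\<not> (odd m \<and> 3 \<le> m)"
        using \<open>\<not> (odd m \<and> 3 \<le> m \<and> c ! (m - 1) \<in> N (c ! 0))\<close> that(3) unfolding ij by blast
      then have "even m" "Suc j = m" using ij that(1) False by linarith+
      then have "odd j" by auto
      then show ?thesis using ij(1) by (simp add: odd_iff_mod_2_eq_one)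
    qed presburger
    have f: "f w = 1 - f u" if u: "u \<in> set c" "w \<in> N u" for u w
    proof -
      obtain i where i: "i < m" "u = c ! i" using setc \<open>u \<in> set c\<close> by blast
      obtain j where j: "j < m" "w = c ! j" using setc C u by blast
      have "i \<noteq> j" using irrefl[of u] i j that inS by auto
      moreover have "u \<in> N w" using sym that c(3) by blast
      ultimately have "i mod 2 \<noteq> j mod 2"
        using lt[of i j] lt[of j i] i j that by (metis linorder_neqE_nat)
      then show ?thesis unfolding f_def i(2) j(2) h[OF i(1)] h[OF j(1)] by (simp add: mod2_eq_if split: if_splits)
    qed
    have "well_loaded N f u" if u: "u \<in> set c" for u
    proof (rule well_loaded_if_alternating)
      have w: "w \<in> set c" "w \<in> S" if "w \<in> N u" for w using C c(3) u that by blast+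
      show "finite (N u)" "card (N u) \<le> 2" using u c(3) finN deg by blast+
      show "f u \<le> 1" unfolding f_def by simp
      show "finite (N w) \<and> card (N w) \<le> 2 \<and> N w \<noteq> {}" if "w \<in> N u" for w
        using w[OF that] finN deg sym[of u w] u c(3) that by blast
      show "f w = 1 - f u" if "w \<in> N u" for w using f u that by blast
      show "f x = f u" if "w \<in> N u" "x \<in> N w" for w x
        using f[OF u that(1)] f[OF w(1)[OF that(1)] that(2)] by (simp add: f_def)
    qed
    then show ?thesis by blast
  next
    case True
    define nxt where "nxt i = (if Suc i = m then 0 else Suc i)" for i
    define prv where "prv i = (if i = 0 then m - 1 else i - 1)" for i
    define f where "f u = odd_cycle_pattern m (h u)" for u
    let ?g = "odd_cycle_pattern m"
    have lt: "nxt i < m" "prv i < m" "nxt i \<noteq> prv i" "nxt (prv i) = i" "prv (nxt i) = i" if "i < m" for i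
      using that True unfolding nxt_def prv_def by auto
    have c0: "c ! 0 \<in> N (c ! (m - 1))" using sym[of "c ! 0"] inS[of 0] True by simp
    have Nc: "N (c ! i) = {c ! nxt i, c ! prv i}" if "i < m" for i
      using lt[OF that] that nbrs[of i "nxt i" "prv i"] step[of i] bwd[of "i - 1"] c0 True
      unfolding nxt_def prv_def m_def by (auto split: if_splits)
    have fc: "f (c ! i) = ?g i" if "i < m" for i unfolding f_def using h that by simp
    have load: "load N f (c ! i) = 3 * ?g i + ?g (nxt i) + ?g (prv i) + 3" if "i < m" for i
      using Nc[OF that] lt[OF that] that eq_iff[of "nxt i" "prv i"] fc
      unfolding load_def by simp
    have pat: "2 * ?g i + ?g (nxt i) + ?g (prv i) < 6"
       "3 * ?g i + ?g (nxt i) + ?g (prv i) \<noteq> 3 * ?g (nxt i) + ?g (nxt (nxt i)) + ?g i" if "i < m" for i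
      using odd_cycle_pattern[of m i] that True unfolding nxt_def prv_def by blast+
    \<comment> \<open>Comparing each position with its successor suffices: the edge to
      \<open>prv i\<close> is the one seen from \<open>prv i\<close>.\<close>
    have nx: "load N f (c ! i) \<noteq> load N f (c ! nxt i)" if "i < m" for i
      using pat(2)[OF that] lt[OF that] load[of i] load[of "nxt i"] that by simp
    have "well_loaded N f (c ! i)" if "i < m" for i
      unfolding well_loaded_def
    proof (intro conjI ballI impI)
      show "f (c ! i) \<le> 2" using fc[OF that] unfolding odd_cycle_pattern_def by simp
      show "load N f (c ! i) \<noteq> load N f w" if "w \<in> N (c ! i)" for w
        using that Nc[OF \<open>i < m\<close>] nx[OF \<open>i < m\<close>] nx[of "prv i"] lt[OF \<open>i < m\<close>] by auto
      show "load N f (c ! i) < 9 + f (c ! i)"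
        using load[OF that] pat(1)[OF that] fc[OF that] by simp
    qed
    then show ?thesis using setc by blast
  qed
  then obtain f where f: "\<And>u. u \<in> set c \<Longrightarrow> well_loaded N f u" by blast
  show thesis
  proof (rule that[of "set c" f])
    show "set c \<noteq> {}" using c(1) by simp
  qed (fact c(3) C f)+
qed

text \<open>Components are split off one at a time: by symmetry of \<open>N\<close> the rest of
  \<open>S\<close> is again closed, and \<open>well_loaded_cong\<close> lets the two weightings be
  merged.\<close>

lemma well_loaded_weighting:
  assumes "finite S"
    and "\<And>u. u \<in> S \<Longrightarrow> N u \<subseteq> S"
    and sym: "\<And>u v. u \<in> S \<Longrightarrow> v \<in> N u \<Longrightarrow> u \<in> N v"
    and "\<And>u. u \<in> S \<Longrightarrow> u \<notin> N u"
    and "\<And>u. u \<in> S \<Longrightarrow> card (N u) \<le> 2"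
  shows "\<exists>f. \<forall>u\<in>S. well_loaded N f u"
  using assms
proof (induction S rule: finite_psubset_induct)
  case (psubset S)
  show ?case
  proof (cases "S = {}")
    case False
    obtain C f where C: "C \<noteq> {}" "C \<subseteq> S" "\<And>u. u \<in> C \<Longrightarrow> N u \<subseteq> C"
      and f: "\<And>u. u \<in> C \<Longrightarrow> well_loaded N f u"
      using closed_component[OF psubset.hyps False psubset.prems] by blast
    have closed: "N u \<subseteq> S - C" if "u \<in> S - C" for u
      using psubset.prems(1,2)[of u] C(3) that by blast
    have "\<exists>g. \<forall>u\<in>S - C. well_loaded N g u"
    proof (rule psubset.IH)
      show "S - C \<subset> S" using C(1,2) by blast
      show "u \<in> N v" if "u \<in> S - C" "v \<in> N u" for u v using psubset.prems(2) that by blast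
      show "u \<notin> N u" "card (N u) \<le> 2" if "u \<in> S - C" for u
        using psubset.prems(3,4) that by blast+
    qed (fact closed)
    then obtain g where g: "\<And>u. u \<in> S - C \<Longrightarrow> well_loaded N g u" by blast
    define k where "k u = (if u \<in> C then f u else g u)" for u
    have "well_loaded N k u" if "u \<in> S" for u
    proof (cases "u \<in> C")
      case True
      then show ?thesis using f well_loaded_cong[of C N k f u] C(3) unfolding k_def by simp
    next
      case False
      then show ?thesis
        using g[of u] well_loaded_cong[of "S - C" N k g u] closed that unfolding k_def by simp
    qed
    then show ?thesis by blast
  qed simp
qed

section \<open>Greedy colouring of hyperedges of size three\<close>

text \<open>
  The value \<open>c\<close> of an uncoloured vertex is blocked by a hyperedge whose other vertices have values
  \<open>x\<close> and \<open>y\<close> if some free vertex of the hyperedge would carry a third of the sum;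
  \<open>P\<close> and \<open>Q\<close> tell whether the other two vertices are free.
\<close>

definition blocked :: "bool \<Rightarrow> bool \<Rightarrow> nat \<Rightarrow> nat \<Rightarrow> nat \<Rightarrow> bool" where
  "blocked P Q x y c \<longleftrightarrow>
     3 * c = c + x + y \<or> P \<and> 3 * x = c + x + y \<or> Q \<and> 3 * y = c + x + y"

text \<open>Being blocked means that \<open>c\<close>, \<open>x\<close>, \<open>y\<close> form, in
  some order, an arithmetic progression, possibly constant, whose middle term is free. The set
  \<open>{0, 1, 3}\<close> contains no nonconstant one, which settles the case of three free
  vertices; the others are a finite check.\<close>

lemma blocked_colour:
  assumes "x \<in> (if P then {0, 1, 3} else {0, 1, 2})" "y \<in> (if Q then {0, 1, 3} else {0, 1, 2})"
    and "c \<in> {0, 1, 3}" "blocked P Q x y c"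
  shows "\<not> blocked P Q x y 2" and "d \<in> {0, 1, 3} \<Longrightarrow> blocked P Q x y d \<Longrightarrow> c = d"
proof -
  have x: "x = 0 \<or> x = 1 \<or> x = 3 \<and> P \<or> x = 2 \<and> \<not> P" using assms(1) by (cases P) auto
  have y: "y = 0 \<or> y = 1 \<or> y = 3 \<and> Q \<or> y = 2 \<and> \<not> Q" using assms(2) by (cases Q) auto
  have c: "c = 0 \<or> c = 1 \<or> c = 3" using assms(3) by auto
  show "\<not> blocked P Q x y 2"
    unfolding blocked_def
    by (insert x y c assms(4)[unfolded blocked_def], (elim disjE conjE; hypsubst; simp))
  show "c = d" if "d \<in> {0, 1, 3}" "blocked P Q x y d"
  proof -
    have d: "d = 0 \<or> d = 1 \<or> d = 3" using that(1) by auto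
    show ?thesis
      by (insert x y c d assms(4)[unfolded blocked_def] that(2)[unfolded blocked_def],
          (elim disjE conjE; hypsubst; simp))
  qed
qed

text \<open>
  Greedy: a hyperedge blocks at most one of \<open>0, 1, 3\<close>. If all three are blocked, then each of the
  three hyperedges at \<open>u\<close> is fully coloured and blocks one of them, hence none blocks \<open>2\<close>; and as
  these hyperedges are complete, this \<open>2\<close> never matters again.
\<close>

lemma hypergraph_colouring:
  fixes N :: "'a \<Rightarrow> 'a set" and f :: "'a \<Rightarrow> nat"
  assumes fin: "finite F"
    and F: "\<And>u. u \<in> F \<Longrightarrow> N u \<subseteq> I \<and> card (N u) = 3"
    and I: "\<And>v. v \<in> I \<Longrightarrow> card (N v) = 3"
    and sym: "\<And>u v. u \<in> F \<Longrightarrow> v \<in> I \<Longrightarrow> v \<in> N u \<longleftrightarrow> u \<in> N v"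
    and f: "\<And>v x. v \<in> I \<Longrightarrow> x \<in> N v - F \<Longrightarrow> f x \<le> 2"
  obtains \<rho> where "\<And>x. x \<notin> F \<Longrightarrow> \<rho> x = f x" "\<And>u. u \<in> F \<Longrightarrow> \<rho> u \<le> 3"
    "\<And>u v. v \<in> I \<Longrightarrow> u \<in> N v \<inter> F \<Longrightarrow> 3 * \<rho> u \<noteq> sum \<rho> (N v)"
proof -
  \<comment> \<open>Induction over the set \<open>T\<close> of free vertices coloured so far. The
    clause on the value 2 ensures that a hyperedge completed later has only 0, 1, 3 on its
    previously coloured free vertices, as \<open>blocked_colour\<close> needs.\<close>
  have "\<exists>\<rho>. (\<forall>x. x \<notin> T \<longrightarrow> \<rho> x = f x) \<and>
      (\<forall>u\<in>T. \<rho> u \<le> 3 \<and> (\<rho> u = 2 \<longrightarrow> (\<forall>v\<in>N u. N v \<inter> F \<subseteq> T))) \<and>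
      (\<forall>v\<in>I. N v \<inter> F \<subseteq> T \<longrightarrow> (\<forall>u\<in>N v \<inter> F. 3 * \<rho> u \<noteq> sum \<rho> (N v)))"
    if "T \<subseteq> F" for T
    using finite_subset[OF that fin] that
  proof (induction T rule: finite_induct)
    case empty
    then show ?case by (intro exI[of _ f]) auto
  next
    case (insert u T)
    then have "T \<subseteq> F" by blast
    from insert.IH[OF this] obtain \<rho>
      where \<rho>': "\<forall>x. x \<notin> T \<longrightarrow> \<rho> x = f x"
        "\<forall>u\<in>T. \<rho> u \<le> 3 \<and> (\<rho> u = 2 \<longrightarrow> (\<forall>v\<in>N u. N v \<inter> F \<subseteq> T))"
        "\<forall>v\<in>I. N v \<inter> F \<subseteq> T \<longrightarrow> (\<forall>u\<in>N v \<inter> F. 3 * \<rho> u \<noteq> sum \<rho> (N v))"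
      by (elim exE conjE)
    have \<rho>: "\<And>x. x \<notin> T \<Longrightarrow> \<rho> x = f x" "\<And>w. w \<in> T \<Longrightarrow> \<rho> w \<le> 3"
      "\<And>w v. w \<in> T \<Longrightarrow> \<rho> w = 2 \<Longrightarrow> v \<in> N w \<Longrightarrow> N v \<inter> F \<subseteq> T"
      "\<And>v w. v \<in> I \<Longrightarrow> N v \<inter> F \<subseteq> T \<Longrightarrow> w \<in> N v \<inter> F \<Longrightarrow> 3 * \<rho> w \<noteq> sum \<rho> (N v)"
      using \<rho>' by blast+
    have u: "u \<in> F" "u \<notin> T" using insert by auto
    define complete where "complete v \<longleftrightarrow> N v \<inter> F \<subseteq> insert u T" for v
    \<comment> \<open>A hyperedge through \<open>u\<close> is tested only when \<open>u\<close> is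
      its last free vertex to be coloured; hence the conjunct \<open>complete v\<close>.\<close>
    define bad where "bad v c \<longleftrightarrow> complete v \<and>
      (\<exists>w\<in>N v \<inter> F. 3 * (\<rho>(u := c)) w = sum (\<rho>(u := c)) (N v))" for v c
    have bad: "\<not> bad v 2" "\<And>d. d \<in> {0, 1, 3} \<Longrightarrow> bad v d \<Longrightarrow> c = d"
      if v: "v \<in> N u" and c: "c \<in> {0, 1, 3}" "bad v c" for v c
    proof -
      have "v \<in> I" using F u(1) v by blast
      have uv: "u \<in> N v" using sym[OF u(1) \<open>v \<in> I\<close>] v by simp
      have "card (N v - {u}) = 2" using I[OF \<open>v \<in> I\<close>] uv by simp
      then obtain x y where xy: "N v - {u} = {x, y}" "x \<noteq> y" by (meson card_2_iff)
      then have Nv: "N v = {u, x, y}" "x \<noteq> u" "y \<noteq> u" using uv by blast+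
      have val: "\<rho> w \<in> (if w \<in> F then {0, 1, 3} else {0, 1, 2})" if w: "w \<in> N v" "w \<noteq> u" for w
      proof (cases "w \<in> F")
        case True
        then have "w \<in> T" using c(2) w unfolding bad_def complete_def by blast
        moreover have "v \<in> N w" using sym[OF True \<open>v \<in> I\<close>] w by simp
        ultimately have "\<rho> w \<noteq> 2" "\<rho> w \<le> 3" using \<rho>(2,3) u uv by blast+
        then show ?thesis using True by simp linarith
      next
        case False
        then have "w \<notin> T" using insert.prems by blast
        then have "\<rho> w \<le> 2" using f[OF \<open>v \<in> I\<close>, of w] \<rho>(1)[of w] w(1) False by simp
        then show ?thesis using False by simp linarith
      qed
      have eq: "bad v d \<longleftrightarrow> blocked (x \<in> F) (y \<in> F) (\<rho> x) (\<rho> y) d" for d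
      proof -
        have "complete v" using c(2) unfolding bad_def by simp
        moreover have "sum (\<rho>(u := d)) (N v) = d + \<rho> x + \<rho> y" using Nv xy(2) by simp
        ultimately show ?thesis unfolding bad_def blocked_def using Nv u(1) by auto
      qed
      have vals: "\<rho> x \<in> (if x \<in> F then {0, 1, 3} else {0, 1, 2})"
        "\<rho> y \<in> (if y \<in> F then {0, 1, 3} else {0, 1, 2})"
        using val Nv by blast+
      note blocked = blocked_colour[OF vals c(1) c(2)[unfolded eq], folded eq]
      show "\<not> bad v 2" by (fact blocked(1))
      show "c = d" if "d \<in> {0, 1, 3}" "bad v d" for d using that by (fact blocked(2))
    qed
    have "\<exists>c\<le>3. (\<forall>v\<in>N u. \<not> bad v c) \<and> (c = 2 \<longrightarrow> (\<forall>v\<in>N u. complete v))"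
    proof (cases "\<exists>c\<in>{0, 1, 3}. \<forall>v\<in>N u. \<not> bad v c")
      case True
      then obtain c where c: "c \<in> {0, 1, 3}" "\<forall>v\<in>N u. \<not> bad v c" by blast
      then have "c \<le> 3" "c \<noteq> 2" by auto
      then show ?thesis using c(2) by blast
    next
      case False
      then have "\<forall>c\<in>{0, 1, 3}. \<exists>v. v \<in> N u \<and> bad v c" by blast
      then obtain a where a: "\<And>c. c \<in> {0, 1, 3} \<Longrightarrow> a c \<in> N u"
        "\<And>c. c \<in> {0, 1, 3} \<Longrightarrow> bad (a c) c"
        by metis
      have inj: "inj_on a {0, 1, 3}"
      proof (rule inj_onI)
        fix c d :: nat assume cd: "c \<in> {0, 1, 3}" "d \<in> {0, 1, 3}" "a c = a d"
        have "bad (a c) d" using a(2)[OF cd(2)] cd(3) by simp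
        then show "c = d" by (rule bad(2)[OF a(1)[OF cd(1)] cd(1) a(2)[OF cd(1)] cd(2)])
      qed
      have "card (a ` {0, 1, 3}) = 3" using card_image[OF inj] by simp
      moreover have "finite (N u)" using F[OF u(1)] by (simp add: card_ge_0_finite)
      moreover have "a ` {0, 1, 3} \<subseteq> N u" using a(1) by blast
      ultimately have "a ` {0, 1, 3} = N u" using F[OF u(1)] by (simp add: card_subset_eq)
      then have "\<not> bad v 2 \<and> complete v" if v: "v \<in> N u" for v
      proof -
        obtain c where c: "c \<in> {0, 1, 3}" "v = a c" using v \<open>a ` {0, 1, 3} = N u\<close> by blast
        then have "bad v c" using a(2) by blast
        then show ?thesis using bad(1)[OF v c(1)] unfolding bad_def by blast
      qed
      then show ?thesis by (intro exI[of _ 2]) auto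
    qed
    then obtain c where c: "c \<le> 3" "\<And>v. v \<in> N u \<Longrightarrow> \<not> bad v c"
      "\<And>v. c = 2 \<Longrightarrow> v \<in> N u \<Longrightarrow> complete v" by blast
    show ?case
    proof (intro exI[of _ "\<rho>(u := c)"] conjI allI ballI impI)
      show "(\<rho>(u := c)) x = f x" if "x \<notin> insert u T" for x using that \<rho>(1) by auto
      show "(\<rho>(u := c)) w \<le> 3" if "w \<in> insert u T" for w using that \<rho>(2) c(1) by auto
      show "N v \<inter> F \<subseteq> insert u T" if "w \<in> insert u T" "(\<rho>(u := c)) w = 2" "v \<in> N w" for w v
        using that \<rho>(3)[of w v] c(3)[of v] unfolding complete_def by (auto split: if_splits)
      show "3 * (\<rho>(u := c)) w \<noteq> sum (\<rho>(u := c)) (N v)"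
        if v: "v \<in> I" "N v \<inter> F \<subseteq> insert u T" and w: "w \<in> N v \<inter> F" for v w
      proof (cases "u \<in> N v")
        case True
        then have "\<not> bad v c" using c(2) sym[OF u(1) v(1)] by blast
        then show ?thesis using v(2) w unfolding bad_def complete_def by blast
      next
        case False
        then have "sum (\<rho>(u := c)) (N v) = sum \<rho> (N v)" "w \<noteq> u"
          using w by (auto intro!: sum.cong)
        then show ?thesis using \<rho>(4)[OF v(1) _ w] v(2) False by auto
      qed
    qed
  qed
  from this[OF subset_refl] show thesis using that by blast
qed

section \<open>Combining both weightings on a cubic graph\<close>

text \<open>This is the pushing condition with the common degree term 3 cancelled on both
  sides.\<close>

lemma cubic_pushing:
  fixes N :: "'a \<Rightarrow> 'a set"
  assumes fin: "finite V"
    and closed: "\<And>u. u \<in> V \<Longrightarrow> N u \<subseteq> V"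
    and cubic: "\<And>u. u \<in> V \<Longrightarrow> card (N u) = 3"
    and irrefl: "\<And>u. u \<in> V \<Longrightarrow> u \<notin> N u"
    and sym: "\<And>u v. u \<in> V \<Longrightarrow> v \<in> N u \<Longrightarrow> u \<in> N v"
  obtains \<rho> :: "'a \<Rightarrow> nat" where "\<And>u. u \<in> V \<Longrightarrow> \<rho> u \<le> 3"
    "\<And>u v. u \<in> V \<Longrightarrow> v \<in> N u \<Longrightarrow> 3 * \<rho> u + sum \<rho> (N u) \<noteq> 3 * \<rho> v + sum \<rho> (N v)"
proof -
  define indep where "indep J \<longleftrightarrow> J \<subseteq> V \<and> (\<forall>u\<in>J. N u \<inter> J = {})" for J
  have "indep {}" unfolding indep_def by simp
  moreover have "card J < Suc (card V)" if "indep J" for J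
    using that card_mono[OF fin] unfolding indep_def by (simp add: less_Suc_eq_le)
  ultimately obtain I where I: "indep I" and max: "\<And>J. indep J \<Longrightarrow> card J \<le> card I"
    using ex_has_greatest_nat[of indep "{}" card "Suc (card V)"] by auto
  have IV: "I \<subseteq> V" and II: "\<And>u. u \<in> I \<Longrightarrow> N u \<inter> I = {}" using I unfolding indep_def by auto
  define M where "M u = N u - I" for u
  have finN: "finite (N u)" if "u \<in> V" for u using closed[OF that] fin finite_subset by blast
  \<comment> \<open>An undominated vertex would enlarge the independent set. One neighbour in
    \<open>I\<close> leaves at most two for \<open>M\<close>, the degree bound of
    \<open>well_loaded_weighting\<close>.\<close>
  have dom: "N u \<inter> I \<noteq> {}" if "u \<in> V - I" for u
  proof
    assume "N u \<inter> I = {}"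
    then have "indep (insert u I)"
      using that I sym irrefl[of u] unfolding indep_def by blast
    then have "card (insert u I) \<le> card I" by (rule max)
    then show False using that finite_subset[OF IV fin] by simp
  qed
  have cardM: "card (M u) + card (N u \<inter> I) = 3" if "u \<in> V" for u
    using cubic[OF that] card_Int_Diff[OF finN[OF that], of I] unfolding M_def by simp
  have "\<exists>f. \<forall>u\<in>V - I. well_loaded M f u"
  proof (rule well_loaded_weighting)
    show "finite (V - I)" using fin by simp
    show "card (M u) \<le> 2" if "u \<in> V - I" for u
    proof -
      have "card (N u \<inter> I) > 0" using dom[OF that] finN[of u] that by (simp add: card_gt_0_iff)
      then show ?thesis using cardM[of u] that by simp
    qed
  qed (use closed sym irrefl in \<open>auto simp: M_def\<close>)
  then obtain f where f: "\<And>u. u \<in> V - I \<Longrightarrow> well_loaded M f u" by blast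
  define g where "g u = (if u \<in> I then 3 else f u)" for u
  \<comment> \<open>At vertices isolated under \<open>M\<close>, \<open>well_loaded\<close> gives
    only \<open>f u \<le> 2\<close>; their values can be chosen anew without disturbing any load
    elsewhere outside \<open>I\<close>.\<close>
  define F where "F = {u \<in> V - I. M u = {}}"
  have FI: "N u \<subseteq> I" if "u \<in> F" for u using that unfolding F_def M_def by auto
  obtain \<rho> where \<rho>: "\<And>x. x \<notin> F \<Longrightarrow> \<rho> x = g x" "\<And>u. u \<in> F \<Longrightarrow> \<rho> u \<le> 3"
    "\<And>u v. v \<in> I \<Longrightarrow> u \<in> N v \<inter> F \<Longrightarrow> 3 * \<rho> u \<noteq> sum \<rho> (N v)"
  \<comment> \<open>Each \<open>v\<close> in \<open>I\<close> contributes the hyperedge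
    \<open>N v\<close>. Independence keeps \<open>I\<close> out of these hyperedges, so the value 3
    of \<open>g\<close> does not occur on them.\<close>
  proof (rule hypergraph_colouring[of F N I g])
    show "finite F" using fin unfolding F_def by simp
    show "N u \<subseteq> I \<and> card (N u) = 3" if "u \<in> F" for u
      using FI cubic that unfolding F_def by blast
    show "card (N v) = 3" if "v \<in> I" for v using cubic IV that by blast
    show "v \<in> N u \<longleftrightarrow> u \<in> N v" if "u \<in> F" "v \<in> I" for u v
      using sym[of u v] sym[of v u] that IV unfolding F_def by blast
    show "g x \<le> 2" if "v \<in> I" "x \<in> N v - F" for v x
    proof -
      have "x \<in> V - I" using II[of v] closed[of v] IV that by blast
      then show ?thesis using f unfolding g_def well_loaded_def by simp
    qed
  qed blast
  have \<rho>I: "\<rho> u = 3" if "u \<in> I" for u using that \<rho>(1)[of u] unfolding g_def F_def by auto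
  have \<rho>f: "\<rho> u = f u" if "u \<in> V - I - F" for u using that \<rho>(1)[of u] unfolding g_def by auto
  have sumI: "sum \<rho> (N u \<inter> I) = 3 * card (N u \<inter> I)" for u
    using \<rho>I by simp
  define \<sigma> where "\<sigma> u = 3 * \<rho> u + sum \<rho> (N u)" for u
  have load: "\<sigma> u = load M f u" if u: "u \<in> V - I - F" for u
  proof -
    \<comment> \<open>By symmetry \<open>u\<close> lies in \<open>M w\<close>, so \<open>w\<close>
      is outside \<open>F\<close> and keeps its value \<open>f w\<close>.\<close>
    have "w \<in> V - I - F" if "w \<in> M u" for w
      using that u closed[of u] sym[of u w] unfolding F_def M_def by blast
    then have "sum \<rho> (M u) = sum f (M u)" using \<rho>f by (intro sum.cong) auto
    moreover have "sum \<rho> (N u) = sum \<rho> (N u \<inter> I) + sum \<rho> (M u)"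
      unfolding M_def using finN u by (intro sum.Int_Diff) blast
    ultimately show ?thesis
      using u \<rho>f[OF u] sumI[of u] cardM[of u] unfolding \<sigma>_def load_def by auto
  qed
  \<comment> \<open>Here \<open>\<sigma> u = 9 + sum \<rho> (N u)\<close>. For \<open>v\<close> in
    \<open>F\<close> all neighbours have value 3, so \<open>\<sigma> v = 3 * \<rho> v + 9\<close>
    and the hyperedge condition separates the two; otherwise
    \<open>\<sigma> v < 9 + \<rho> v\<close>, and \<open>\<rho> v\<close> is one of the summands in
    \<open>\<sigma> u\<close>.\<close>
  have IO: "\<sigma> u \<noteq> \<sigma> v" if "u \<in> I" "v \<in> N u" for u v
  proof (cases "v \<in> F")
    case True
    then have "\<sigma> v = 3 * \<rho> v + 9"
      using FI[OF True] sumI[of v] cubic[of v] unfolding \<sigma>_def F_def by (auto simp: Int_absorb2)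
    then show ?thesis using \<rho>(3)[of u v] \<rho>I[of u] that True unfolding \<sigma>_def by auto
  next
    case False
    then have v: "v \<in> V - I - F" using that closed[of u] II[of u] IV by blast
    then have "M v \<noteq> {}" unfolding F_def by blast
    then have "\<sigma> v < 9 + \<rho> v" using f[of v] v load[OF v] \<rho>f[OF v] unfolding well_loaded_def by simp
    also have "\<dots> \<le> \<sigma> u"
      using \<rho>I[of u] that member_le_sum[of v "N u" \<rho>] finN[of u] IV unfolding \<sigma>_def by auto
    finally show ?thesis by simp
  qed
  show thesis
  proof (rule that)
    show "\<rho> u \<le> 3" if "u \<in> V" for u
      using \<rho>(2)[of u] \<rho>I[of u] \<rho>f[of u] f[of u] that unfolding well_loaded_def by fastforce
    show "3 * \<rho> u + sum \<rho> (N u) \<noteq> 3 * \<rho> v + sum \<rho> (N v)" if uv: "u \<in> V" "v \<in> N u" for u v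
    proof -
      have vu: "v \<in> V" "u \<in> N v" using uv closed sym by blast+
      have "\<sigma> u \<noteq> \<sigma> v"
      proof (cases "u \<in> I \<or> v \<in> I")
        case True
        then show ?thesis using IO[of u v] IO[of v u] uv vu by metis
      next
        case False
        then have "v \<in> M u" "u \<in> M v" using uv vu unfolding M_def by auto
        then have "u \<in> V - I - F" "v \<in> V - I - F" using False uv vu unfolding F_def by auto
        then show ?thesis using f[of u] \<open>v \<in> M u\<close> load unfolding well_loaded_def by auto
      qed
      then show ?thesis unfolding \<sigma>_def .
    qed
  qed
qed

section \<open>Transfer to the digraph model\<close>

lemma out_degree_eq_card_nbhd:
  "out_degree (with_proj G) u = card (nbhd G u)"
proof -
  have "out_arcs (with_proj G) u = Pair u ` nbhd G u"
    unfolding nbhd_def by (auto simp: out_arcs_def)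
  then show ?thesis unfolding out_degree_def by (simp add: card_image inj_on_def)
qed

theorem theorem1:
  fixes G :: "'a pair_pre_digraph"
  assumes "cubic_graph G"
  shows "P1 G \<le> 3 \<and>
    (\<exists>\<rho> :: 'a \<Rightarrow> nat. proper_pushing_scheme G \<rho> \<and> (\<forall>u\<in>pverts G. \<rho> u \<in> {0, 1, 2, 3}))"
proof -
  interpret pair_graph G using assms unfolding cubic_graph_def by blast
  have arcsD: "u \<in> pverts G" "v \<in> pverts G" if "(u, v) \<in> parcs G" for u v
    using arc_fst_in_verts arc_snd_in_verts that by force+
  have card: "card (nbhd G u) = 3" if "u \<in> pverts G" for u
    using assms that unfolding cubic_graph_def by (simp add: out_degree_eq_card_nbhd)
  obtain \<rho> :: "'a \<Rightarrow> nat" where \<rho>: "\<And>u. u \<in> pverts G \<Longrightarrow> \<rho> u \<le> 3"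
    "\<And>u v. u \<in> pverts G \<Longrightarrow> v \<in> nbhd G u \<Longrightarrow>
      3 * \<rho> u + sum \<rho> (nbhd G u) \<noteq> 3 * \<rho> v + sum \<rho> (nbhd G v)"
  proof (rule cubic_pushing[of "pverts G" "nbhd G"])
    show "nbhd G u \<subseteq> pverts G" for u using arcsD unfolding nbhd_def by blast
    show "u \<notin> nbhd G u" for u using pair_no_loops unfolding nbhd_def by force
    show "u \<in> nbhd G v" if "v \<in> nbhd G u" for u v
      using that pair_sym_arcs unfolding nbhd_def symmetric_def by (auto dest: symD)
    show "finite (pverts G)" by simp
  qed (use card in blast)+
  have proper: "proper_pushing_scheme G \<rho>"
    unfolding proper_pushing_scheme_def
  proof (intro allI impI)
    fix u v assume uv: "(u, v) \<in> parcs G"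
    have "push_sigma G \<rho> w = 3 + (3 * \<rho> w + sum \<rho> (nbhd G w))" if "w \<in> pverts G" for w
      unfolding push_sigma_def out_degree_eq_card_nbhd card[OF that] by simp
    then show "push_sigma G \<rho> u \<noteq> push_sigma G \<rho> v"
      using \<rho>(2)[of u v] arcsD[OF uv] uv unfolding nbhd_def by simp
  qed
  have "(SUP u\<in>pverts G. \<rho> u) \<le> 3"
  \<comment> \<open>\<open>cSUP_least\<close> asks for a nonempty index set; for the graph without
    vertices the supremum is the default \<open>Sup {} = 0\<close>.\<close>
  proof (cases "pverts G = {}")
    case False
    then show ?thesis using \<rho>(1) by (intro cSUP_least)
  qed (simp add: Sup_nat_def)
  moreover have "P1 G \<le> (SUP u\<in>pverts G. \<rho> u)"
    unfolding P1_def using proper by (intro cInf_lower) auto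
  moreover have "\<rho> u \<in> {0, 1, 2, 3}" if "u \<in> pverts G" for u
  proof -
    have "\<rho> u = 0 \<or> \<rho> u = 1 \<or> \<rho> u = 2 \<or> \<rho> u = 3" using \<rho>(1)[OF that] by linarith
    then show ?thesis by simp
  qed
  ultimately show ?thesis using proper by fastforce
qed

end
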